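(* Suppose there exists a $Q_B$-set $X\subseteq 2^\omega$ of cardinality $\lambda$, where $\mathrm{cf}(\lambda)>\omega$. Then the following are equivalent: (1) there exists a cardinality-preserving nontrivial automorphism of $\mathcal{P}(\lambda)/\mathrm{Ctble}$; (2) there exists a $Q_B$-set $Y\subseteq 2^\omega$ such that $X\triangle Y$ is uncountable and, for every Borel $B\subseteq 2^\omega$, $|B\cap X|+\aleph_0=|B\cap Y|+\aleph_0$.
   Context: A set $X\subseteq 2^\omega$ is a $Q_B$-set if for every $Y\subseteq X$ there is a Borel $B\subseteq 2^\omega$ with $B\cap X=Y$. $\mathrm{Ctble}$ is the ideal of countable subsets of $\lambda$. An automorphism $\pi$ is cardinality-preserving if for every $A\subseteq\lambda$ there is $B$ with $|B|=|A|$ and $\pi([A])=[B]$; it is trivial if there is $f:\lambda\to\lambda$ with $\pi([A])=[f^{-1}(A)]$ for all $A\subseteq\lambda$. *)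

theory Defs
  imports "HOL-Analysis.Analysis"
begin

unbundle cardinal_syntax

definition QB_set :: "(nat \<Rightarrow> bool) set \<Rightarrow> bool" where
  "QB_set X \<longleftrightarrow> (\<forall>Y\<subseteq>X. \<exists>B\<in>sets borel. B \<inter> X = Y)"

text \<open>
  The library's \<open>cofinal\<close> is strict, so no subset of a successor ordinal satisfies it; the
  non-strict version below makes the whole field cofinal in every well-order.
\<close>
definition cofinal_in :: "'a set \<Rightarrow> 'a rel \<Rightarrow> bool" where
  "cofinal_in A r \<longleftrightarrow> A \<subseteq> Field r \<and> (\<forall>a\<in>Field r. \<exists>b\<in>A. (a, b) \<in> r)"

definition cofinality :: "'a rel \<Rightarrow> 'a rel" where
  "cofinality r = |SOME A. cofinal_in A r \<and> (\<forall>B. cofinal_in B r \<longrightarrow> |A| \<le>o |B| )|"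

lemma cofinality_witness:
  fixes r :: "'a rel"
  assumes "Card_order r"
  shows "\<exists>A. cofinal_in A r \<and> cofinality r = |A| \<and> (\<forall>B. cofinal_in B r \<longrightarrow> |A| \<le>o |B| )"
proof -
  define R where "R = {|A| |A. cofinal_in A r}"
  have wo: "Well_order r"
    using assms by (simp add: card_order_on_def)
  then have "refl_on (Field r) r"
    by (simp add: order_on_defs)
  then have "cofinal_in (Field r) r"
    by (auto simp: cofinal_in_def refl_on_def)
  then have "R \<noteq> {}"
    by (auto simp: R_def)
  moreover have "\<forall>p\<in>R. Card_order p"
    by (auto simp: R_def card_of_Card_order)
  ultimately obtain p where "p \<in> R" "\<forall>q\<in>R. p \<le>o q"
    using exists_minim_Card_order by blast
  then have ex: "\<exists>A. cofinal_in A r \<and> (\<forall>B. cofinal_in B r \<longrightarrow> |A| \<le>o |B| )"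
    by (auto simp: R_def)
  show ?thesis
    using someI_ex[OF ex] unfolding cofinality_def by blast
qed

definition Ctble :: "'a set \<Rightarrow> 'a set set" where
  "Ctble L = {A. A \<subseteq> L \<and> countable A}"

definition eq_mod_Ctble :: "'a set \<Rightarrow> 'a set rel" where
  "eq_mod_Ctble L = {(A, B). A \<subseteq> L \<and> B \<subseteq> L \<and> sym_diff A B \<in> Ctble L}"

definition cls :: "'a set \<Rightarrow> 'a set \<Rightarrow> 'a set set" where
  "cls L A = eq_mod_Ctble L `` {A}"

definition Pow_mod_Ctble :: "'a set \<Rightarrow> 'a set set set" where
  "Pow_mod_Ctble L = Pow L // eq_mod_Ctble L"

text \<open>
  The Boolean operations of the quotient, lifted through all representatives; the unions are over
  identical sets by the congruence lemmas below.
\<close>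
definition join_Ctble :: "'a set \<Rightarrow> 'a set set \<Rightarrow> 'a set set \<Rightarrow> 'a set set" where
  "join_Ctble L x y = (\<Union>A\<in>x. \<Union>B\<in>y. cls L (A \<union> B))"

definition meet_Ctble :: "'a set \<Rightarrow> 'a set set \<Rightarrow> 'a set set \<Rightarrow> 'a set set" where
  "meet_Ctble L x y = (\<Union>A\<in>x. \<Union>B\<in>y. cls L (A \<inter> B))"

definition compl_Ctble :: "'a set \<Rightarrow> 'a set set \<Rightarrow> 'a set set" where
  "compl_Ctble L x = (\<Union>A\<in>x. cls L (L - A))"

lemma in_eq_mod_Ctble_iff:
  "(A, B) \<in> eq_mod_Ctble L \<longleftrightarrow> A \<subseteq> L \<and> B \<subseteq> L \<and> countable (sym_diff A B)"
  by (auto simp: eq_mod_Ctble_def Ctble_def)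

lemma equiv_eq_mod_Ctble: "equiv (Pow L) (eq_mod_Ctble L)"
proof (rule equivI)
  show "eq_mod_Ctble L \<subseteq> Pow L \<times> Pow L"
    by (auto simp: in_eq_mod_Ctble_iff)
  show "refl_on (Pow L) (eq_mod_Ctble L)"
    by (auto simp: refl_on_def in_eq_mod_Ctble_iff)
  show "sym (eq_mod_Ctble L)"
    by (auto simp: sym_def in_eq_mod_Ctble_iff)
  show "trans (eq_mod_Ctble L)"
  proof (rule transI)
    fix A B C assume *: "(A, B) \<in> eq_mod_Ctble L" "(B, C) \<in> eq_mod_Ctble L"
    have "sym_diff A C \<subseteq> sym_diff A B \<union> sym_diff B C" by blast
    moreover have "countable (sym_diff A B \<union> sym_diff B C)"
      using * by (simp add: in_eq_mod_Ctble_iff)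
    ultimately show "(A, C) \<in> eq_mod_Ctble L"
      using * by (meson countable_subset in_eq_mod_Ctble_iff)
  qed
qed

lemma cls_eq_iff:
  assumes "A \<subseteq> L" "B \<subseteq> L"
  shows "cls L A = cls L B \<longleftrightarrow> countable (sym_diff A B)"
  using eq_equiv_class_iff[OF equiv_eq_mod_Ctble[of L], of A B] assms
  by (simp add: cls_def in_eq_mod_Ctble_iff)

lemma join_Ctble_cls:
  assumes "A \<subseteq> L" "B \<subseteq> L"
  shows "join_Ctble L (cls L A) (cls L B) = cls L (A \<union> B)"
proof -
  have "cls L (A' \<union> B') = cls L (A \<union> B)" if "A' \<in> cls L A" "B' \<in> cls L B" for A' B'
  proof -
    have "sym_diff (A' \<union> B') (A \<union> B) \<subseteq> sym_diff A A' \<union> sym_diff B B'" by blast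
    moreover have "countable (sym_diff A A' \<union> sym_diff B B')"
      using that by (simp add: cls_def in_eq_mod_Ctble_iff)
    ultimately have "countable (sym_diff (A' \<union> B') (A \<union> B))"
      by (rule countable_subset)
    moreover have "A' \<subseteq> L" "B' \<subseteq> L"
      using that by (simp_all add: cls_def in_eq_mod_Ctble_iff)
    ultimately show ?thesis
      using assms by (subst cls_eq_iff) auto
  qed
  moreover have "A \<in> cls L A" "B \<in> cls L B"
    using assms by (simp_all add: cls_def in_eq_mod_Ctble_iff)
  ultimately show ?thesis unfolding join_Ctble_def by blast
qed

lemma meet_Ctble_cls:
  assumes "A \<subseteq> L" "B \<subseteq> L"
  shows "meet_Ctble L (cls L A) (cls L B) = cls L (A \<inter> B)"
proof -
  have "cls L (A' \<inter> B') = cls L (A \<inter> B)" if "A' \<in> cls L A" "B' \<in> cls L B" for A' B'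
  proof -
    have "sym_diff (A' \<inter> B') (A \<inter> B) \<subseteq> sym_diff A A' \<union> sym_diff B B'" by blast
    moreover have "countable (sym_diff A A' \<union> sym_diff B B')"
      using that by (simp add: cls_def in_eq_mod_Ctble_iff)
    ultimately have "countable (sym_diff (A' \<inter> B') (A \<inter> B))"
      by (rule countable_subset)
    moreover have "A' \<subseteq> L" "B' \<subseteq> L"
      using that by (simp_all add: cls_def in_eq_mod_Ctble_iff)
    ultimately show ?thesis
      using assms by (subst cls_eq_iff) auto
  qed
  moreover have "A \<in> cls L A" "B \<in> cls L B"
    using assms by (simp_all add: cls_def in_eq_mod_Ctble_iff)
  ultimately show ?thesis unfolding meet_Ctble_def by blast
qed

lemma compl_Ctble_cls:
  assumes "A \<subseteq> L"
  shows "compl_Ctble L (cls L A) = cls L (L - A)"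
proof -
  have "cls L (L - A') = cls L (L - A)" if "A' \<in> cls L A" for A'
  proof -
    have "sym_diff (L - A') (L - A) \<subseteq> sym_diff A A'" by blast
    moreover have "countable (sym_diff A A')"
      using that by (simp add: cls_def in_eq_mod_Ctble_iff)
    ultimately have "countable (sym_diff (L - A') (L - A))"
      by (rule countable_subset)
    then show ?thesis
      by (subst cls_eq_iff) auto
  qed
  moreover have "A \<in> cls L A"
    using assms by (simp add: cls_def in_eq_mod_Ctble_iff)
  ultimately show ?thesis unfolding compl_Ctble_def by blast
qed

definition automorphism :: "'a set \<Rightarrow> ('a set set \<Rightarrow> 'a set set) \<Rightarrow> bool" where
  "automorphism L \<pi> \<longleftrightarrow>
     bij_betw \<pi> (Pow_mod_Ctble L) (Pow_mod_Ctble L) \<and>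
     \<pi> (cls L {}) = cls L {} \<and> \<pi> (cls L L) = cls L L \<and>
     (\<forall>x\<in>Pow_mod_Ctble L. \<forall>y\<in>Pow_mod_Ctble L.
        \<pi> (join_Ctble L x y) = join_Ctble L (\<pi> x) (\<pi> y) \<and>
        \<pi> (meet_Ctble L x y) = meet_Ctble L (\<pi> x) (\<pi> y)) \<and>
     (\<forall>x\<in>Pow_mod_Ctble L. \<pi> (compl_Ctble L x) = compl_Ctble L (\<pi> x))"

definition cardinality_preserving :: "'a set \<Rightarrow> ('a set set \<Rightarrow> 'a set set) \<Rightarrow> bool" where
  "cardinality_preserving L \<pi> \<longleftrightarrow>
     (\<forall>A\<subseteq>L. \<exists>B\<subseteq>L. |B| =o |A| \<and> \<pi> (cls L A) = cls L B)"

definition trivial_automorphism :: "'a set \<Rightarrow> ('a set set \<Rightarrow> 'a set set) \<Rightarrow> bool" where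
  "trivial_automorphism L \<pi> \<longleftrightarrow>
     (\<exists>f\<in>L \<rightarrow> L. \<forall>A\<subseteq>L. \<pi> (cls L A) = cls L (f -` A \<inter> L))"

end

theory Submission
  imports Defs
begin

text \<open>
  A \<open>Q\<^sub>B\<close>-set \<open>X\<close> identifies \<open>\<P>(\<lambda>)/Ctble\<close> with the algebra of Borel sets modulo those meeting \<open>X\<close> in
  a countable set. An automorphism preserves the countable joins, hence is determined by its
  values on the traces of the subbasic clopen sets; collecting these values into one map
  \<open>h : \<lambda> \<rightarrow> 2\<^sup>\<omega>\<close> yields \<open>\<pi>[B \<inter> X] = [h\<^sup>-\<^sup>1 B]\<close> for every Borel \<open>B\<close>, and \<open>Y\<close> is the range of \<open>h\<close>.
  Conversely \<open>[B \<inter> X] \<mapsto> [B \<inter> Y]\<close> is an automorphism, and if a point map induces it, testing on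
  clopen sets shows that the point map is the identity off a countable set.
\<close>

section \<open>Cardinalities modulo countable sets\<close>

lemma countable_iff_le_natLeq: "countable A \<longleftrightarrow> |A| \<le>o natLeq"
proof -
  have "countable A \<longleftrightarrow> |A| \<le>o |UNIV :: nat set|"
    unfolding countable_def card_of_ordLeq[symmetric] by auto
  then show ?thesis
    using card_of_nat ordIso_symmetric ordLeq_ordIso_trans by blast
qed

lemma uncountable_iff_natLeq_less: "uncountable A \<longleftrightarrow> natLeq <o |A|"
  unfolding countable_iff_le_natLeq
  by (simp add: card_of_Well_order natLeq_Well_order not_ordLeq_iff_ordLess)

lemma countable_csum_natLeq: "countable A \<Longrightarrow> |A| +c natLeq =o natLeq"
  unfolding countable_iff_le_natLeq
  by (simp add: csum_absorb2 natLeq_cinfinite natLeq_Card_order)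

lemma uncountable_csum_natLeq: "uncountable A \<Longrightarrow> |A| +c natLeq =o |A|"
  unfolding uncountable_iff_natLeq_less
  by (meson card_of_Card_order cinfinite_mono csum_absorb1 natLeq_cinfinite ordLess_imp_ordLeq)

text \<open>Adding \<open>natLeq\<close> raises every countable cardinal to aleph_0 and fixes every
  uncountable one. Hence a comparison of sums becomes a case split: both sets are countable, or they
  are equinumerous.\<close>

lemma csum_natLeq_ordIso_iff:
  "|A| +c natLeq =o |B| +c natLeq \<longleftrightarrow> countable A \<and> countable B \<or> |A| =o |B|"
proof
  assume "countable A \<and> countable B \<or> |A| =o |B|"
  then show "|A| +c natLeq =o |B| +c natLeq"
  proof (elim disjE conjE)
    assume "countable A" "countable B"
    then show ?thesis
      by (rule ordIso_transitive[OF countable_csum_natLeq ordIso_symmetric[OF countable_csum_natLeq]])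
  qed (rule csum_cong1)
next
  assume eq: "|A| +c natLeq =o |B| +c natLeq"
  have "|A| =o |B|" if A: "uncountable A" and B: "uncountable B"
    using ordIso_transitive[OF ordIso_symmetric[OF uncountable_csum_natLeq[OF A]]
        ordIso_transitive[OF eq uncountable_csum_natLeq[OF B]]] .
  moreover have False if A: "uncountable A" and B: "countable B"
    using A ordIso_imp_ordLeq[OF ordIso_transitive[OF ordIso_symmetric[OF uncountable_csum_natLeq[OF A]]
        ordIso_transitive[OF eq countable_csum_natLeq[OF B]]]]
    by (simp add: countable_iff_le_natLeq)
  moreover have False if A: "countable A" and B: "uncountable B"
    using B ordIso_imp_ordLeq[OF ordIso_transitive[OF ordIso_symmetric[OF uncountable_csum_natLeq[OF B]]
        ordIso_transitive[OF ordIso_symmetric[OF eq] countable_csum_natLeq[OF A]]]]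
    by (simp add: countable_iff_le_natLeq)
  ultimately show "countable A \<and> countable B \<or> |A| =o |B|"
    by blast
qed

lemma countable_ordLeq_uncountable:
  assumes "countable A" "uncountable B"
  shows "|A| \<le>o |B|"
  using assms unfolding countable_iff_le_natLeq uncountable_iff_natLeq_less[unfolded countable_iff_le_natLeq]
  by (rule ordLess_imp_ordLeq[OF ordLeq_ordLess_trans])

text \<open>The set \<open>A - N\<close> stays uncountable, so it dominates \<open>N\<close> and
  absorbs it in the union.\<close>

lemma card_of_Diff_countable:
  assumes "uncountable A" "countable N"
  shows "|A - N| =o |A|"
proof -
  have unc: "uncountable (A - N)"
    using assms by (metis uncountable_minus_countable)
  have "|N| \<le>o |A - N|"
    using assms(2) unc by (rule countable_ordLeq_uncountable)
  moreover have "infinite (A - N)"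
    using unc countable_finite by blast
  ultimately have "|(A - N) \<union> N| \<le>o |A - N|"
    by (intro card_of_Un_ordLeq_infinite_Field) (simp_all add: Field_card_of card_of_mono1 card_of_card_order_on)
  then have "|A| \<le>o |A - N|"
    using ordLeq_transitive[OF card_of_mono1[of A "(A - N) \<union> N"]] by blast
  then show ?thesis
    by (simp add: ordIso_iff_ordLeq card_of_mono1)
qed

lemma csum_natLeq_cong_mod_countable:
  assumes "countable (sym_diff A B)"
  shows "|A| +c natLeq =o |B| +c natLeq"
proof -
  have cA: "countable (A - B)" and cB: "countable (B - A)"
    using assms by auto
  \<comment> \<open>Both differences are the intersection of \<open>A\<close> and \<open>B\<close>,
    which therefore arises from either set by removing a countable part.\<close>
  have AB: "A - (A - B) = B - (B - A)" "A \<subseteq> B \<union> (A - B)" "B \<subseteq> A \<union> (B - A)"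
    by auto
  show ?thesis
  proof (cases "countable A")
    case True
    then have "countable B"
      using AB(3) cB countable_Un countable_subset by blast
    with True show ?thesis by (simp add: csum_natLeq_ordIso_iff)
  next
    case False
    then have "uncountable B"
      using AB(2) cA countable_Un countable_subset by blast
    then have "|B - (B - A)| =o |B|" "|A - (A - B)| =o |A|"
      using False cA cB by (simp_all only: card_of_Diff_countable not_False_eq_True)
    then have "|A| =o |B|"
      unfolding AB(1) by (metis ordIso_symmetric ordIso_transitive)
    then show ?thesis by (simp add: csum_natLeq_ordIso_iff)
  qed
qed

text \<open>\<open>S\<close> is a union of countable fibres indexed by its image. An uncountable
  image absorbs them; a countable one leaves \<open>S\<close> countable. This replaces injectivity
  when cardinalities are carried along a map that is only countable-to-one.\<close>

lemma csum_natLeq_countable_to_one_image: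
  assumes "\<And>p. countable (h -` {p} \<inter> S)"
  shows "|S| +c natLeq =o |h ` S| +c natLeq"
proof -
  have S: "S = (\<Union>p\<in>h ` S. h -` {p} \<inter> S)" by auto
  show ?thesis
  proof (cases "countable (h ` S)")
    case True
    then have "countable S"
      using assms by (subst S) (rule countable_UN)
    with True show ?thesis by (simp add: csum_natLeq_ordIso_iff)
  next
    case False
    then have "|h -` {p} \<inter> S| \<le>o |h ` S|" for p
      by (intro countable_ordLeq_uncountable assms)
    moreover have "infinite (h ` S)"
      using False countable_finite by blast
    ultimately have "|\<Union>p\<in>h ` S. h -` {p} \<inter> S| \<le>o |h ` S|"
      by (intro card_of_UNION_ordLeq_infinite) (auto simp: card_of_mono1)
    then have "|S| =o |h ` S|"
      using S card_of_image[of h S] by (simp add: ordIso_iff_ordLeq)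
    then show ?thesis by (simp add: csum_natLeq_ordIso_iff)
  qed
qed

section \<open>Borel subsets of Cantor space\<close>

text \<open>Second countability of the factors identifies the Borel sets of the product topology on
  \<open>nat \<Rightarrow> bool\<close> with its product sigma-algebra.\<close>

instance bool :: second_countable_topology
proof
  show "\<exists>B :: bool set set. countable B \<and> open = generate_topology B"
    by (intro exI[of _ "range (\<lambda>a. {..<a}) \<union> range (\<lambda>a. {a<..})"]) (simp add: open_bool_def)
qed

text \<open>With the coordinate sets as generators, a claim about all Borel sets can be proved by
  induction through complements and countable unions.\<close>

lemma sets_borel_cantor:
  "sets (borel :: (nat \<Rightarrow> bool) measure) = sigma_sets UNIV (range (\<lambda>n. {x. x n}))"
  (is "_ = sigma_sets UNIV ?G")
proof -
  have "sets (borel :: (nat \<Rightarrow> bool) measure) = sets (Pi\<^sub>M UNIV (\<lambda>_. borel :: bool measure))"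
    by (simp add: sets_PiM_equal_borel)
  also have "\<dots> = sigma_sets UNIV {{f. f i \<in> A} |i A. A \<in> sets (borel :: bool measure)}"
    by (subst sets_PiM_single) simp
  also have "\<dots> = sigma_sets UNIV ?G"
  proof (rule sigma_sets_eqI)
    fix S assume "S \<in> {{f :: nat \<Rightarrow> bool. f i \<in> A} |i A. A \<in> sets (borel :: bool measure)}"
    then obtain i A where S: "S = {f. f i \<in> A}" by blast
    have i: "{x. x i} \<in> sigma_sets UNIV ?G" by (rule sigma_sets.Basic) blast
    \<comment> \<open>There are only four sets of truth values, hence four cylinders over the
      coordinate \<open>i\<close>.\<close>
    have "S = {} \<or> S = UNIV \<or> S = {x. x i} \<or> S = UNIV - {x. x i}"
      unfolding S by (cases "True \<in> A"; cases "False \<in> A") (auto, (metis (full_types))+)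
    then show "S \<in> sigma_sets UNIV ?G"
      using i sigma_sets.Compl[OF i] sigma_sets.Empty[of UNIV ?G] sigma_sets_top[of UNIV ?G] by auto
  next
    fix S assume "S \<in> ?G"
    then obtain i where S: "S = {f. f i \<in> {True}}" by auto
    have "{True} \<in> sets (borel :: bool measure)" by simp
    with S show "S \<in> sigma_sets UNIV {{f. f i \<in> A} |i A. A \<in> sets (borel :: bool measure)}"
      by (intro sigma_sets.Basic) blast
  qed
  finally show ?thesis .
qed

lemma coordinate_borel: "{x :: nat \<Rightarrow> bool. x n} \<in> sets borel"
  unfolding sets_borel_cantor by (rule sigma_sets.Basic) blast

lemma countable_borel_cantor:
  fixes C :: "(nat \<Rightarrow> bool) set"
  assumes "countable C"
  shows "C \<in> sets borel"
proof (rule sets.countable[OF _ assms])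
  fix a :: "nat \<Rightarrow> bool"
  have "{x. x n = a n} \<in> sets borel" for n
  proof -
    have "{x. x n = a n} = (if a n then {x. x n} else - {x. x n})" by auto
    then show ?thesis using coordinate_borel[of n] by auto
  qed
  then have "(\<Inter>n. {x. x n = a n}) \<in> sets borel" by blast
  moreover have "(\<Inter>n. {x. x n = a n}) = {a}" by auto
  ultimately show "{a} \<in> sets borel" by simp
qed

text \<open>Distinct points of Cantor space differ at some coordinate, so the disagreement set is
  covered by countably many errors, one for each \<open>{x. x n}\<close>.\<close>

lemma countable_disagreement:
  fixes g h :: "'a \<Rightarrow> nat \<Rightarrow> bool"
  assumes "\<And>B. B \<in> sets borel \<Longrightarrow> countable (sym_diff (g -` B \<inter> L) (h -` B \<inter> L))"
  shows "countable {l \<in> L. g l \<noteq> h l}"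
proof (rule countable_subset)
  show "{l \<in> L. g l \<noteq> h l} \<subseteq> (\<Union>n. sym_diff (g -` {x. x n} \<inter> L) (h -` {x. x n} \<inter> L))"
    by (auto simp: fun_eq_iff)
  show "countable \<dots>"
    using assms[OF coordinate_borel] by blast
qed

section \<open>Automorphisms on representatives\<close>

lemma cls_in_Pow_mod_Ctble: "A \<subseteq> L \<Longrightarrow> cls L A \<in> Pow_mod_Ctble L"
  by (auto simp: Pow_mod_Ctble_def cls_def quotient_def)

lemma Pow_mod_CtbleE:
  assumes "x \<in> Pow_mod_Ctble L"
  obtains A where "A \<subseteq> L" "x = cls L A"
  using assms by (auto simp: Pow_mod_Ctble_def cls_def quotient_def)

text \<open>\<open>\<phi>\<close> picks a representative of the image of each class, so it respects
  the set operations only up to countable errors. The later clauses say that it preserves and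
  reflects the order of the quotient, respects complements, and is surjective modulo countable
  sets.\<close>

lemma automorphism_representatives:
  assumes "automorphism L \<pi>"
  shows "\<exists>\<phi>. (\<forall>A\<subseteq>L. \<phi> A \<subseteq> L \<and> \<pi> (cls L A) = cls L (\<phi> A)) \<and>
    (\<forall>A\<subseteq>L. \<forall>B\<subseteq>L. countable (\<phi> A - \<phi> B) \<longleftrightarrow> countable (A - B)) \<and>
    (\<forall>A\<subseteq>L. countable (sym_diff (\<phi> (L - A)) (L - \<phi> A))) \<and>
    (\<forall>C\<subseteq>L. \<exists>A\<subseteq>L. countable (sym_diff (\<phi> A) C))"
proof -
  have bij: "bij_betw \<pi> (Pow_mod_Ctble L) (Pow_mod_Ctble L)"
    using assms by (simp add: automorphism_def)
  have "\<exists>C\<subseteq>L. \<pi> (cls L A) = cls L C" if "A \<subseteq> L" for A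
    by (metis that bij bij_betwE cls_in_Pow_mod_Ctble Pow_mod_CtbleE)
  then obtain \<phi> where \<phi>: "\<And>A. A \<subseteq> L \<Longrightarrow> \<phi> A \<subseteq> L" "\<And>A. A \<subseteq> L \<Longrightarrow> \<pi> (cls L A) = cls L (\<phi> A)"
    by metis
  show ?thesis
  proof (intro exI[of _ \<phi>] conjI allI impI)
    fix A assume "A \<subseteq> L"
    then show "\<phi> A \<subseteq> L" "\<pi> (cls L A) = cls L (\<phi> A)" by (fact \<phi>)+
  next
    fix A B assume AB: "A \<subseteq> L" "B \<subseteq> L"
    \<comment> \<open>The order is written as an equation between a meet and a class, so that
      injectivity of \<open>\<pi>\<close> can be applied to it.\<close>
    have le: "countable (C - D) \<longleftrightarrow> cls L (C \<inter> D) = cls L C" if "C \<subseteq> L" "D \<subseteq> L" for C D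
    proof -
      have "sym_diff (C \<inter> D) C = C - D" by blast
      then show ?thesis using that by (subst cls_eq_iff) auto
    qed
    have "\<pi> (cls L (A \<inter> B)) = cls L (\<phi> A \<inter> \<phi> B)"
      using assms AB \<phi> by (simp add: automorphism_def cls_in_Pow_mod_Ctble flip: meet_Ctble_cls)
    then have "countable (\<phi> A - \<phi> B) \<longleftrightarrow> \<pi> (cls L (A \<inter> B)) = \<pi> (cls L A)"
      using AB \<phi> by (simp add: le)
    also have "\<dots> \<longleftrightarrow> cls L (A \<inter> B) = cls L A"
      using AB by (intro inj_on_eq_iff[OF bij_betw_imp_inj_on[OF bij]] cls_in_Pow_mod_Ctble) auto
    also have "\<dots> \<longleftrightarrow> countable (A - B)"
      using AB by (simp add: le)
    finally show "countable (\<phi> A - \<phi> B) \<longleftrightarrow> countable (A - B)" .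
  next
    fix A assume A: "A \<subseteq> L"
    have "cls L (\<phi> (L - A)) = \<pi> (cls L (L - A))"
      using \<phi> by simp
    also have "\<dots> = cls L (L - \<phi> A)"
      using assms A \<phi> by (simp add: automorphism_def cls_in_Pow_mod_Ctble flip: compl_Ctble_cls)
    finally show "countable (sym_diff (\<phi> (L - A)) (L - \<phi> A))"
      by (subst (asm) cls_eq_iff) (use A \<phi> in auto)
  next
    fix C assume C: "C \<subseteq> L"
    then obtain x where x: "x \<in> Pow_mod_Ctble L" "\<pi> x = cls L C"
      by (metis bij bij_betw_def cls_in_Pow_mod_Ctble imageE)
    obtain A where A: "A \<subseteq> L" "x = cls L A"
      using x(1) Pow_mod_CtbleE by blast
    have "cls L (\<phi> A) = cls L C"
      using A x(2) \<phi> by metis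
    then show "\<exists>A\<subseteq>L. countable (sym_diff (\<phi> A) C)"
      using A(1) C \<phi>(1) cls_eq_iff by metis
  qed
qed

section \<open>Countable joins and the point map of an automorphism\<close>

lemma countable_Diff_trans: "countable (A - B) \<Longrightarrow> countable (B - C) \<Longrightarrow> countable (A - C)"
  by (rule countable_subset[of _ "(A - B) \<union> (B - C)"]) auto

lemma countable_UN_Diff_UN:
  fixes A B :: "nat \<Rightarrow> 'a set"
  assumes "\<And>i. countable (A i - B i)"
  shows "countable ((\<Union>i. A i) - (\<Union>i. B i))"
  by (rule countable_subset[of _ "\<Union>i. A i - B i"]) (use assms in auto)

text \<open>An order isomorphism preserves suprema, and the class of a countable union is the
  supremum of the classes because countably many countable errors have a countable union.
  Monotonicity gives one inclusion; the other uses that the union is least, tested after pulling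
  back along \<open>\<phi>\<close>.\<close>

lemma representatives_countable_union:
  fixes A C :: "nat \<Rightarrow> 'a set"
  assumes mono: "\<And>A B. A \<subseteq> L \<Longrightarrow> B \<subseteq> L \<Longrightarrow> countable (\<phi> A - \<phi> B) \<longleftrightarrow> countable (A - B)"
    and surj: "\<And>C. C \<subseteq> L \<Longrightarrow> \<exists>A\<subseteq>L. countable (sym_diff (\<phi> A) C)"
    and A: "\<And>i. A i \<subseteq> L" and C: "\<And>i. C i \<subseteq> L"
    and AC: "\<And>i. countable (sym_diff (\<phi> (A i)) (C i))"
  shows "countable (sym_diff (\<phi> (\<Union>i. A i)) (\<Union>i. C i))"
proof -
  have UA: "(\<Union>i. A i) \<subseteq> L" using A by blast
  have "countable (C i - \<phi> (\<Union>i. A i))" for i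
  proof (rule countable_Diff_trans)
    show "countable (C i - \<phi> (A i))" using AC[of i] by simp
    have "A i - (\<Union>i. A i) = {}" by blast
    then show "countable (\<phi> (A i) - \<phi> (\<Union>i. A i))" using mono[OF A[of i] UA] by (metis countable_empty)
  qed
  then have 1: "countable ((\<Union>i. C i) - \<phi> (\<Union>i. A i))"
    using countable_UN_Diff_UN[of C "\<lambda>_. \<phi> (\<Union>i. A i)"] by simp
  have UC: "(\<Union>i. C i) \<subseteq> L" using C by blast
  \<comment> \<open>\<open>D\<close> is a preimage of the union of the \<open>C i\<close>. It lies
    above every \<open>A i\<close> modulo countable sets, hence above their union.\<close>
  obtain D where D: "D \<subseteq> L" "countable (sym_diff (\<phi> D) (\<Union>i. C i))"
    using surj[OF UC] by (elim exE conjE)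
  have "countable (A i - D)" for i
  proof -
    have "countable (\<phi> (A i) - C i)" using AC[of i] by simp
    moreover have "countable (C i - \<phi> D)"
      by (rule countable_subset[of _ "(\<Union>i. C i) - \<phi> D"]) (use D in auto)
    ultimately have "countable (\<phi> (A i) - \<phi> D)" by (rule countable_Diff_trans)
    then show ?thesis using mono[OF A[of i] D(1)] by simp
  qed
  then have "countable ((\<Union>i. A i) - D)"
    using countable_UN_Diff_UN[of A "\<lambda>_. D"] by simp
  then have "countable (\<phi> (\<Union>i. A i) - \<phi> D)"
    using mono[OF UA D(1)] by simp
  then have "countable (\<phi> (\<Union>i. A i) - (\<Union>i. C i))"
    using D(2) countable_Diff_trans by (metis countable_Un_iff)
  with 1 show ?thesis by simp
qed

lemma automorphism_borel_representation:
  fixes e :: "'a \<Rightarrow> nat \<Rightarrow> bool"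
  assumes "automorphism L \<pi>"
  shows "\<exists>h :: 'a \<Rightarrow> nat \<Rightarrow> bool. \<forall>B\<in>sets borel. \<pi> (cls L (e -` B \<inter> L)) = cls L (h -` B \<inter> L)"
proof -
  obtain \<phi> where all: "\<forall>A\<subseteq>L. \<phi> A \<subseteq> L \<and> \<pi> (cls L A) = cls L (\<phi> A)"
    "\<forall>A\<subseteq>L. \<forall>B\<subseteq>L. countable (\<phi> A - \<phi> B) \<longleftrightarrow> countable (A - B)"
    "\<forall>A\<subseteq>L. countable (sym_diff (\<phi> (L - A)) (L - \<phi> A))"
    "\<forall>C\<subseteq>L. \<exists>A\<subseteq>L. countable (sym_diff (\<phi> A) C)"
    using automorphism_representatives[OF assms] by (elim exE conjE)
  note \<phi> = all(1)[THEN spec, THEN mp, THEN conjunct1] all(1)[THEN spec, THEN mp, THEN conjunct2]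
  note mono = all(2)[THEN spec, THEN mp, THEN spec, THEN mp]
  note compl = all(3)[THEN spec, THEN mp]
  note surj = all(4)[THEN spec, THEN mp]
  \<comment> \<open>The n-th coordinate of \<open>h l\<close> records whether \<open>l\<close> lies
    in the chosen image of the trace of \<open>{x. x n}\<close>. The coordinate sets thus satisfy
    the claim without error, and the induction only accumulates countable errors.\<close>
  define h where "h l n \<longleftrightarrow> l \<in> \<phi> (e -` {x. x n} \<inter> L)" for l n
  have *: "countable (sym_diff (\<phi> (e -` B \<inter> L)) (h -` B \<inter> L))"
    if "B \<in> sigma_sets UNIV (range (\<lambda>n. {x. x n}))" for B
    using that
  proof induction
    case (Basic B)
    then obtain n where B: "B = {x. x n}" by blast
    have "h -` B \<inter> L = \<phi> (e -` B \<inter> L)"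
      using \<phi>(1)[of "e -` B \<inter> L"] unfolding B by (auto simp: h_def)
    then show ?case by simp
  next
    \<comment> \<open>\<open>\<phi> {}\<close> need not be empty, but it lies modulo a countable set
      below a set \<open>\<phi> A\<close> that is itself countable.\<close>
    case Empty
    obtain A where A: "A \<subseteq> L" "countable (sym_diff (\<phi> A) {})"
      using surj[of "{}"] by auto
    have "countable (\<phi> {} - \<phi> A)"
      using mono[of "{}" A] A by simp
    then show ?case
      using A countable_Diff_trans[of "\<phi> {}" "\<phi> A" "{}"] by simp
  next
    case (Compl B)
    have eq: "k -` (UNIV - B) \<inter> L = L - (k -` B \<inter> L)" for k :: "'a \<Rightarrow> nat \<Rightarrow> bool"
      by auto
    show ?case
      unfolding eq
    proof (rule countable_subset)
      show "countable (sym_diff (\<phi> (L - (e -` B \<inter> L))) (L - \<phi> (e -` B \<inter> L))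
              \<union> sym_diff (\<phi> (e -` B \<inter> L)) (h -` B \<inter> L))"
        using compl[of "e -` B \<inter> L"] Compl.IH by simp
    qed blast
  next
    case (Union B)
    have eq: "k -` (\<Union>i. B i) \<inter> L = (\<Union>i. k -` B i \<inter> L)" for k :: "'a \<Rightarrow> nat \<Rightarrow> bool"
      by auto
    show ?case
      unfolding eq by (rule representatives_countable_union[OF mono surj]) (use Union.IH in auto)
  qed
  show ?thesis
  proof (intro exI[of _ h] ballI)
    fix B :: "(nat \<Rightarrow> bool) set" assume "B \<in> sets borel"
    then have "cls L (\<phi> (e -` B \<inter> L)) = cls L (h -` B \<inter> L)"
      using *[of B] \<phi>(1)[of "e -` B \<inter> L"] by (subst cls_eq_iff) (auto simp: sets_borel_cantor)
    then show "\<pi> (cls L (e -` B \<inter> L)) = cls L (h -` B \<inter> L)"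
      using \<phi>(2)[of "e -` B \<inter> L"] by simp
  qed
qed

section \<open>From automorphisms to sets and back\<close>

text \<open>The defining property of a \<open>QB_set\<close>, moved to the index set
  \<open>L\<close>: injectivity of \<open>e\<close> recovers \<open>A\<close> from its
  image.\<close>

lemma QB_set_trace:
  assumes "QB_set X" "bij_betw e L X" "A \<subseteq> L"
  obtains B where "B \<in> sets borel" "e -` B \<inter> L = A"
proof -
  have "e ` A \<subseteq> X" using assms by (auto simp: bij_betw_def)
  then obtain B where B: "B \<in> sets borel" "B \<inter> X = e ` A"
    using assms(1) unfolding QB_set_def by blast
  have inj: "inj_on e L" and X: "X = e ` L"
    using assms(2) by (auto simp: bij_betw_def)
  have "e -` B \<inter> L = A"
  proof
    show "e -` B \<inter> L \<subseteq> A"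
    proof
      fix l assume l: "l \<in> e -` B \<inter> L"
      then have "e l \<in> e ` A" using B(2) X by blast
      then show "l \<in> A" using l inj assms(3) by (auto dest: inj_onD)
    qed
    show "A \<subseteq> e -` B \<inter> L"
      using B(2) assms(3) by blast
  qed
  with B(1) show ?thesis by (rule that)
qed

lemma card_of_trace:
  assumes "bij_betw e L X"
  shows "|e -` B \<inter> L| =o |B \<inter> X|"
proof -
  have "bij_betw e (e -` B \<inter> L) (B \<inter> X)"
    using assms by (auto simp: bij_betw_def inj_on_def)
  then show ?thesis using card_of_ordIsoI by blast
qed

section \<open>An automorphism from a second set\<close>

lemma countable_iff_ordIso: "|A| =o |B| \<Longrightarrow> countable A \<longleftrightarrow> countable B"
  unfolding countable_iff_le_natLeq
  by (metis ordIso_ordLeq_trans ordIso_symmetric)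

text \<open>Both families of traces exhaust the subsets of \<open>L\<close>, and they have the same
  Borel null sets. The correspondence of traces is therefore well defined and bijective on classes,
  and it respects the operations because preimages do.\<close>

lemma automorphism_of_traces:
  fixes e g :: "'a \<Rightarrow> nat \<Rightarrow> bool"
  assumes E: "\<And>A. A \<subseteq> L \<Longrightarrow> \<exists>B\<in>sets borel. e -` B \<inter> L = A"
    and G: "\<And>A. A \<subseteq> L \<Longrightarrow> \<exists>B\<in>sets borel. g -` B \<inter> L = A"
    and EG: "\<And>B. B \<in> sets borel \<Longrightarrow> countable (e -` B \<inter> L) \<longleftrightarrow> countable (g -` B \<inter> L)"
  shows "\<exists>\<pi>. automorphism L \<pi> \<and> (\<forall>B\<in>sets borel. \<pi> (cls L (e -` B \<inter> L)) = cls L (g -` B \<inter> L))"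
proof -
  \<comment> \<open>Hypothesis \<open>EG\<close>, applied to the symmetric difference of
    \<open>B\<close> and \<open>C\<close>, gives well-definedness in one direction and injectivity
    in the other.\<close>
  have iff: "cls L (e -` B \<inter> L) = cls L (e -` C \<inter> L) \<longleftrightarrow> cls L (g -` B \<inter> L) = cls L (g -` C \<inter> L)"
    if "B \<in> sets borel" "C \<in> sets borel" for B C
  proof -
    have "sym_diff (k -` B \<inter> L) (k -` C \<inter> L) = k -` sym_diff B C \<inter> L" for k :: "'a \<Rightarrow> nat \<Rightarrow> bool"
      by blast
    then show ?thesis
      using that EG[of "sym_diff B C"] by (simp add: cls_eq_iff)
  qed
  have ex: "\<exists>B\<in>sets borel. x = cls L (k -` B \<inter> L)"
    if "x \<in> Pow_mod_Ctble L" "k = e \<or> k = g" for x k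
    using that E G by (metis Pow_mod_CtbleE)
  \<comment> \<open>\<open>b x\<close> is an arbitrary Borel code of the class \<open>x\<close>; by
    \<open>iff\<close> its choice does not affect \<open>\<pi>\<close>.\<close>
  define b where "b x = (SOME B. B \<in> sets borel \<and> x = cls L (e -` B \<inter> L))" for x
  define \<pi> where "\<pi> x = cls L (g -` b x \<inter> L)" for x
  have \<pi>: "\<pi> (cls L (e -` B \<inter> L)) = cls L (g -` B \<inter> L)" if "B \<in> sets borel" for B
  proof -
    have "b (cls L (e -` B \<inter> L)) \<in> sets borel \<and>
        cls L (e -` B \<inter> L) = cls L (e -` b (cls L (e -` B \<inter> L)) \<inter> L)"
      unfolding b_def by (rule someI[of _ B]) (use that in simp)
    then show ?thesis
      unfolding \<pi>_def using iff[OF that] by blast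
  qed
  have triv: "k -` B \<inter> L \<subseteq> L" for k and B :: "(nat \<Rightarrow> bool) set" by blast
  have ops: "(k -` B \<inter> L) \<union> (k -` C \<inter> L) = k -` (B \<union> C) \<inter> L"
    "(k -` B \<inter> L) \<inter> (k -` C \<inter> L) = k -` (B \<inter> C) \<inter> L"
    "L - (k -` B \<inter> L) = k -` (- B) \<inter> L" for k :: "'a \<Rightarrow> nat \<Rightarrow> bool" and B C
    by auto
  have "automorphism L \<pi>"
    unfolding automorphism_def
  proof (intro conjI ballI)
    show "bij_betw \<pi> (Pow_mod_Ctble L) (Pow_mod_Ctble L)"
    proof (rule bij_betw_imageI)
      show "inj_on \<pi> (Pow_mod_Ctble L)"
      proof (rule inj_onI)
        fix x y assume "x \<in> Pow_mod_Ctble L" "y \<in> Pow_mod_Ctble L" and eq: "\<pi> x = \<pi> y"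
        then obtain B C where "B \<in> sets borel" "x = cls L (e -` B \<inter> L)"
          "C \<in> sets borel" "y = cls L (e -` C \<inter> L)"
          using ex by metis
        with eq show "x = y" by (simp add: \<pi> iff)
      qed
      show "\<pi> ` Pow_mod_Ctble L = Pow_mod_Ctble L"
      proof
        show "\<pi> ` Pow_mod_Ctble L \<subseteq> Pow_mod_Ctble L"
          unfolding \<pi>_def by (auto intro!: cls_in_Pow_mod_Ctble)
        show "Pow_mod_Ctble L \<subseteq> \<pi> ` Pow_mod_Ctble L"
        proof
          fix y assume "y \<in> Pow_mod_Ctble L"
          then obtain B where "B \<in> sets borel" "y = cls L (g -` B \<inter> L)"
            using ex by metis
          then show "y \<in> \<pi> ` Pow_mod_Ctble L"
            by (intro image_eqI[of _ _ "cls L (e -` B \<inter> L)"]) (auto simp: \<pi> cls_in_Pow_mod_Ctble)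
        qed
      qed
    qed
    show "\<pi> (cls L {}) = cls L {}" "\<pi> (cls L L) = cls L L"
      using \<pi>[of "{}"] \<pi>[of UNIV] by simp_all
  next
    fix x y assume "x \<in> Pow_mod_Ctble L" "y \<in> Pow_mod_Ctble L"
    then obtain B C where "B \<in> sets borel" "x = cls L (e -` B \<inter> L)"
      "C \<in> sets borel" "y = cls L (e -` C \<inter> L)"
      using ex by metis
    then show "\<pi> (join_Ctble L x y) = join_Ctble L (\<pi> x) (\<pi> y)"
      "\<pi> (meet_Ctble L x y) = meet_Ctble L (\<pi> x) (\<pi> y)"
      by (simp_all only: \<pi> join_Ctble_cls[OF triv triv] meet_Ctble_cls[OF triv triv] ops
          sets.Un sets.Int)
  next
    fix x assume "x \<in> Pow_mod_Ctble L"
    then obtain B where "B \<in> sets borel" "x = cls L (e -` B \<inter> L)"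
      using ex by metis
    then show "\<pi> (compl_Ctble L x) = compl_Ctble L (\<pi> x)"
      by (simp only: \<pi> compl_Ctble_cls[OF triv] ops borel_comp)
  qed
  then show ?thesis using \<pi> by blast
qed

lemma nontrivial_automorphism_of_QB_set:
  assumes "QB_set X" "bij_betw e L X" "QB_set Y" and unc: "uncountable (sym_diff X Y)"
    and card: "\<And>B. B \<in> sets borel \<Longrightarrow> |B \<inter> X| +c natLeq =o |B \<inter> Y| +c natLeq"
  shows "\<exists>\<pi>. automorphism L \<pi> \<and> cardinality_preserving L \<pi> \<and> \<not> trivial_automorphism L \<pi>"
proof -
  \<comment> \<open>For \<open>B = UNIV\<close> the countable alternative would make the symmetric
    difference of \<open>X\<close> and \<open>Y\<close> countable.\<close>
  have "|X| =o |Y|"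
    using card[of UNIV] unc by (auto simp: csum_natLeq_ordIso_iff)
  moreover have "|L| =o |X|"
    using assms(2) card_of_ordIsoI by blast
  ultimately obtain g where g: "bij_betw g L Y"
    using card_of_ordIso by (metis ordIso_transitive)
  have cXY: "countable (B \<inter> X) \<longleftrightarrow> countable (B \<inter> Y)" if "B \<in> sets borel" for B
    using card[OF that] countable_iff_ordIso by (auto simp: csum_natLeq_ordIso_iff)
  have EG: "countable (e -` B \<inter> L) \<longleftrightarrow> countable (g -` B \<inter> L)" if "B \<in> sets borel" for B
    using cXY[OF that] countable_iff_ordIso[OF card_of_trace[OF g, of B]]
      countable_iff_ordIso[OF card_of_trace[OF assms(2), of B]] by simp
  have E: "\<exists>B\<in>sets borel. e -` B \<inter> L = A" if "A \<subseteq> L" for A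
    by (rule QB_set_trace[OF assms(1,2) that]) (rule bexI)
  have G: "\<exists>B\<in>sets borel. g -` B \<inter> L = A" if "A \<subseteq> L" for A
    by (rule QB_set_trace[OF assms(3) g that]) (rule bexI)
  have "\<exists>\<pi>. automorphism L \<pi> \<and> (\<forall>B\<in>sets borel. \<pi> (cls L (e -` B \<inter> L)) = cls L (g -` B \<inter> L))"
    by (intro automorphism_of_traces E G EG)
  then obtain \<pi> where auto: "automorphism L \<pi>"
    and all: "\<forall>B\<in>sets borel. \<pi> (cls L (e -` B \<inter> L)) = cls L (g -` B \<inter> L)"
    by (elim exE conjE)
  note \<pi> = bspec[OF all]
  have "cardinality_preserving L \<pi>"
    unfolding cardinality_preserving_def
  proof (intro allI impI)
    fix A assume A: "A \<subseteq> L"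
    obtain B where B: "B \<in> sets borel" "e -` B \<inter> L = A"
      by (rule QB_set_trace[OF assms(1,2) A])
    have "|A| =o |B \<inter> X|" "|g -` B \<inter> L| =o |B \<inter> Y|"
      using card_of_trace[OF assms(2), of B] card_of_trace[OF g, of B] B by auto
    show "\<exists>C\<subseteq>L. |C| =o |A| \<and> \<pi> (cls L A) = cls L C"
    proof (cases "countable (B \<inter> X) \<and> countable (B \<inter> Y)")
      \<comment> \<open>The two traces may have different countable sizes, but both represent the
        zero class, so \<open>A\<close> itself serves as the representative.\<close>
      case True
      then have "countable A" "countable (g -` B \<inter> L)"
        using \<open>|A| =o |B \<inter> X|\<close> \<open>|g -` B \<inter> L| =o |B \<inter> Y|\<close> countable_iff_ordIso by blast+
      then have "cls L (g -` B \<inter> L) = cls L A"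
        using A by (subst cls_eq_iff) auto
      then show ?thesis
        using \<pi>[OF B(1)] A B(2) by (intro exI[of _ A]) (simp add: card_of_refl)
    next
      case False
      then have "|B \<inter> X| =o |B \<inter> Y|"
        using card[OF B(1)] by (auto simp: csum_natLeq_ordIso_iff)
      then have "|g -` B \<inter> L| =o |A|"
        using \<open>|A| =o |B \<inter> X|\<close> \<open>|g -` B \<inter> L| =o |B \<inter> Y|\<close>
        by (metis ordIso_symmetric ordIso_transitive)
      then show ?thesis
        using \<pi>[OF B(1)] B(2) by (intro exI[of _ "g -` B \<inter> L"]) simp
    qed
  qed
  moreover have "\<not> trivial_automorphism L \<pi>"
  proof
    assume "trivial_automorphism L \<pi>"
    then obtain f where f: "f \<in> L \<rightarrow> L" "\<And>A. A \<subseteq> L \<Longrightarrow> \<pi> (cls L A) = cls L (f -` A \<inter> L)"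
      unfolding trivial_automorphism_def by blast
    have "countable (sym_diff (g -` B \<inter> L) ((e \<circ> f) -` B \<inter> L))" if "B \<in> sets borel" for B
    proof -
      have "f -` (e -` B \<inter> L) \<inter> L = (e \<circ> f) -` B \<inter> L"
        using f(1) by auto
      then have "cls L (g -` B \<inter> L) = cls L ((e \<circ> f) -` B \<inter> L)"
        using \<pi>[OF that] f(2)[of "e -` B \<inter> L"] by simp
      then show ?thesis by (subst (asm) cls_eq_iff) auto
    qed
    \<comment> \<open>A point map \<open>f\<close> inducing \<open>\<pi>\<close> gives
      \<open>e \<circ> f\<close> and \<open>g\<close> the same Borel traces modulo countable sets,
      so they agree off a countable set. There \<open>g\<close> takes values in \<open>X\<close>,
      which bounds \<open>Y - X\<close>.\<close>
    then have "countable {l \<in> L. g l \<noteq> (e \<circ> f) l}"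
      by (rule countable_disagreement)
    then have "countable (g ` {l \<in> L. g l \<noteq> (e \<circ> f) l})"
      by (rule countable_image)
    moreover have "Y - X \<subseteq> g ` {l \<in> L. g l \<noteq> (e \<circ> f) l}"
    proof
      fix y assume y: "y \<in> Y - X"
      then obtain l where l: "l \<in> L" "y = g l"
        using g by (auto simp: bij_betw_def)
      have "(e \<circ> f) l \<in> X"
        using f(1) l(1) assms(2) by (auto simp: bij_betw_def)
      with y l show "y \<in> g ` {l \<in> L. g l \<noteq> (e \<circ> f) l}" by auto
    qed
    ultimately have YX: "countable (Y - X)"
      using countable_subset by blast
    \<comment> \<open>For the other half no point map is needed: the trace of \<open>B\<close> on
      \<open>Y\<close> lies in the countable set \<open>Y - X\<close>, and the cardinality condition
      carries countability over to \<open>X - Y\<close>.\<close>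
    obtain B where B: "B \<in> sets borel" "B \<inter> X = X - Y"
      using assms(1) unfolding QB_set_def by blast
    have "B \<inter> Y \<subseteq> Y - X" using B(2) by blast
    then have "countable (X - Y)"
      using YX cXY[OF B(1)] B(2) countable_subset by metis
    with YX unc show False by simp
  qed
  ultimately show ?thesis using auto by blast
qed

section \<open>A second set from an automorphism\<close>

lemma QB_set_of_nontrivial_automorphism:
  assumes "QB_set X" and e: "bij_betw e L X"
    and auto: "automorphism L \<pi>" and card: "cardinality_preserving L \<pi>"
    and nontriv: "\<not> trivial_automorphism L \<pi>"
  shows "\<exists>Y. QB_set Y \<and> uncountable (sym_diff X Y) \<and>
    (\<forall>B\<in>sets borel. |B \<inter> X| +c natLeq =o |B \<inter> Y| +c natLeq)"
proof -
  obtain h where all: "\<forall>B\<in>sets borel. \<pi> (cls L (e -` B \<inter> L)) = cls L (h -` B \<inter> L)"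
    using automorphism_borel_representation[OF auto, of e] by (elim exE)
  note h = bspec[OF all]
  define Y where "Y = h ` L"
  \<comment> \<open>Preservation provides some representative \<open>C\<close> of the right size. It
    differs from the preimage under \<open>h\<close> by a countable set, which adding
    \<open>natLeq\<close> hides.\<close>
  have preimage_card: "|B \<inter> X| +c natLeq =o |h -` B \<inter> L| +c natLeq" if "B \<in> sets borel" for B
  proof -
    obtain C where C: "C \<subseteq> L" "|C| =o |e -` B \<inter> L|" "\<pi> (cls L (e -` B \<inter> L)) = cls L C"
      using card unfolding cardinality_preserving_def by (meson inf_le2)
    then have "cls L C = cls L (h -` B \<inter> L)"
      using h[OF that] by simp
    then have "|C| +c natLeq =o |h -` B \<inter> L| +c natLeq"
      using C(1) by (intro csum_natLeq_cong_mod_countable) (simp add: cls_eq_iff)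
    moreover have "|B \<inter> X| +c natLeq =o |C| +c natLeq"
      using csum_cong1[OF ordIso_symmetric[OF ordIso_transitive[OF C(2) card_of_trace[OF e, of B]]]] .
    ultimately show ?thesis by (rule ordIso_transitive[rotated])
  qed
  \<comment> \<open>Countable sets are Borel, so \<open>preimage_card\<close> applies to them and
    makes \<open>h\<close> countable-to-one.\<close>
  have fibre: "countable (h -` C \<inter> L)" if "countable C" for C
  proof -
    have "countable (C \<inter> X)" using that by simp
    then show ?thesis
      using preimage_card[OF countable_borel_cantor[OF that]] countable_iff_ordIso
      by (auto simp: csum_natLeq_ordIso_iff)
  qed
  have "|B \<inter> X| +c natLeq =o |B \<inter> Y| +c natLeq" if "B \<in> sets borel" for B
  proof -
    have "countable (h -` {p} \<inter> (h -` B \<inter> L))" for p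
      by (rule countable_subset[OF _ fibre[of "{p}"]]) auto
    then have "|h -` B \<inter> L| +c natLeq =o |h ` (h -` B \<inter> L)| +c natLeq"
      by (rule csum_natLeq_countable_to_one_image)
    moreover have "h ` (h -` B \<inter> L) = B \<inter> Y"
      by (auto simp: Y_def)
    ultimately show ?thesis
      using preimage_card[OF that] ordIso_transitive by metis
  qed
  moreover have "QB_set Y"
    unfolding QB_set_def
  proof (intro allI impI)
    fix Z assume Z: "Z \<subseteq> Y"
    \<comment> \<open>Surjectivity of \<open>\<pi>\<close> pulls this class back to that of some
      \<open>A\<close>, which is the trace of a Borel set \<open>B\<close>. Then \<open>B\<close>
      cuts \<open>Z\<close> out of \<open>Y\<close> up to a countable error.\<close>
    have "cls L (h -` Z \<inter> L) \<in> \<pi> ` Pow_mod_Ctble L"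
      using auto cls_in_Pow_mod_Ctble[of "h -` Z \<inter> L" L] by (simp add: automorphism_def bij_betw_def)
    then obtain x where x: "x \<in> Pow_mod_Ctble L" "\<pi> x = cls L (h -` Z \<inter> L)"
      by auto
    obtain A where "A \<subseteq> L" "x = cls L A"
      using Pow_mod_CtbleE[OF x(1)] .
    with x have A: "A \<subseteq> L" "\<pi> (cls L A) = cls L (h -` Z \<inter> L)"
      by simp_all
    obtain B where B: "B \<in> sets borel" "e -` B \<inter> L = A"
      by (rule QB_set_trace[OF assms(1) e A(1)])
    have "cls L (h -` B \<inter> L) = cls L (h -` Z \<inter> L)"
      using h[OF B(1)] A(2) B(2) by simp
    then have "countable (sym_diff (h -` B \<inter> L) (h -` Z \<inter> L))"
      by (subst (asm) cls_eq_iff) auto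
    then have "countable (h ` sym_diff (h -` B \<inter> L) (h -` Z \<inter> L))"
      by (rule countable_image)
    moreover have "sym_diff (B \<inter> Y) Z \<subseteq> h ` sym_diff (h -` B \<inter> L) (h -` Z \<inter> L)"
      using Z by (auto simp: Y_def)
    ultimately have N: "countable (sym_diff (B \<inter> Y) Z)"
      using countable_subset by blast
    show "\<exists>B\<in>sets borel. B \<inter> Y = Z"
    proof
      have "countable (B \<inter> Y - Z)" "countable (Z - B \<inter> Y)" using N by auto
      \<comment> \<open>The countable error is repaired by removing the surplus points and adding
        the missing ones, both countable and hence Borel sets.\<close>
      then show "(B - (B \<inter> Y - Z)) \<union> (Z - B \<inter> Y) \<in> sets borel"
        by (rule sets.Un[OF sets.Diff[OF B(1) countable_borel_cantor] countable_borel_cantor])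
      show "((B - (B \<inter> Y - Z)) \<union> (Z - B \<inter> Y)) \<inter> Y = Z"
        using Z by blast
    qed
  qed
  moreover have "uncountable (sym_diff X Y)"
  proof
    assume "countable (sym_diff X Y)"
    then have "countable (Y - X)" by simp
    then have bad: "countable (h -` (Y - X) \<inter> L)" by (rule fibre)
    txt \<open>Off this countable set \<open>h\<close> takes values in \<open>X\<close>, so it lifts through \<open>e\<close> to a point map on \<open>L\<close>.\<close>
    define f where "f l = (if h l \<in> X then inv_into L e (h l) else l)" for l
    have f: "f \<in> L \<rightarrow> L"
      using e by (auto simp: f_def bij_betw_def inv_into_into)
    have "\<pi> (cls L A) = cls L (f -` A \<inter> L)" if A: "A \<subseteq> L" for A
    proof -
      obtain B where B: "B \<in> sets borel" "e -` B \<inter> L = A"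
        by (rule QB_set_trace[OF assms(1) e A])
      have ef: "e (f l) = h l" if "h l \<in> X" for l
        using that e by (auto simp: f_def bij_betw_def f_inv_into_f)
      \<comment> \<open>Where \<open>h l\<close> lies in \<open>X\<close>,
        \<open>e (f l) = h l\<close> makes \<open>f l \<in> A\<close> equivalent to
        \<open>h l \<in> B\<close>, so the two preimages differ only where \<open>h\<close> leaves
        \<open>X\<close>.\<close>
      have "sym_diff (h -` B \<inter> L) (f -` A \<inter> L) \<subseteq> h -` (Y - X) \<inter> L"
      proof
        fix l assume l: "l \<in> sym_diff (h -` B \<inter> L) (f -` A \<inter> L)"
        then have "l \<in> L" by blast
        have "f l \<in> L" using f \<open>l \<in> L\<close> by blast
        then have "h l \<notin> X"
          using l ef[of l] B(2) by auto
        then show "l \<in> h -` (Y - X) \<inter> L"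
          using \<open>l \<in> L\<close> by (simp add: Y_def)
      qed
      then have "countable (sym_diff (h -` B \<inter> L) (f -` A \<inter> L))"
        using bad by (rule countable_subset)
      then have "cls L (h -` B \<inter> L) = cls L (f -` A \<inter> L)"
        by (subst cls_eq_iff) auto
      then show ?thesis using h[OF B(1)] B(2) by simp
    qed
    then have "trivial_automorphism L \<pi>"
      unfolding trivial_automorphism_def using f by blast
    with nontriv show False by blast
  qed
  ultimately show ?thesis by blast
qed

theorem theorem5p6:
  fixes lam :: "'a rel" and X :: "(nat \<Rightarrow> bool) set"
  assumes "Card_order lam"
    and "natLeq <o cofinality lam"
    and "QB_set X"
    and "|X| =o lam"
  shows
    "(\<exists>\<pi>. automorphism (Field lam) \<pi> \<and> cardinality_preserving (Field lam) \<pi> \<and>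
          \<not> trivial_automorphism (Field lam) \<pi>)
     \<longleftrightarrow>
     (\<exists>Y :: (nat \<Rightarrow> bool) set. QB_set Y \<and> uncountable (sym_diff X Y) \<and>
          (\<forall>B\<in>sets borel. |B \<inter> X| +c natLeq =o |B \<inter> Y| +c natLeq))"
proof -
  \<comment> \<open>An enumeration \<open>e\<close> of \<open>X\<close> by the field of
    \<open>lam\<close> presents the subsets of the field as traces of Borel sets.\<close>
  have "|Field lam| =o |X|"
    using ordIso_transitive[OF card_of_Field_ordIso[OF assms(1)] ordIso_symmetric[OF assms(4)]] .
  then obtain e where e: "bij_betw e (Field lam) X"
    using card_of_ordIso by blast
  show ?thesis
  proof
    assume "\<exists>\<pi>. automorphism (Field lam) \<pi> \<and> cardinality_preserving (Field lam) \<pi> \<and>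
          \<not> trivial_automorphism (Field lam) \<pi>"
    then show "\<exists>Y. QB_set Y \<and> uncountable (sym_diff X Y) \<and>
          (\<forall>B\<in>sets borel. |B \<inter> X| +c natLeq =o |B \<inter> Y| +c natLeq)"
      using QB_set_of_nontrivial_automorphism[OF assms(3) e] by blast
  next
    assume "\<exists>Y. QB_set Y \<and> uncountable (sym_diff X Y) \<and>
          (\<forall>B\<in>sets borel. |B \<inter> X| +c natLeq =o |B \<inter> Y| +c natLeq)"
    then show "\<exists>\<pi>. automorphism (Field lam) \<pi> \<and> cardinality_preserving (Field lam) \<pi> \<and>
          \<not> trivial_automorphism (Field lam) \<pi>"
      using nontrivial_automorphism_of_QB_set[OF assms(3) e] by blast
  qed
qed

end
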